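(* Let $M$ be a manifold. For each pair $(\mathcal A,\mathcal B)$ among $(\mathcal K,\mathcal O)$, $(\mathcal K,\Lambda)$, $(\mathcal K,\Omega)$, $(\mathcal K,\mathcal K)$, $(\Omega,\mathcal O)$, $(\Omega,\Lambda)$, $(\Omega,\Omega)$, $(\Lambda,\mathcal O)$, $(\Lambda,\Lambda)$, $(\mathcal O,\mathcal O)$, the manifold $M$ is metrisable if and only if $M$ satisfies the selection principle $\mathsf S_{fin}(\mathcal A,\mathcal B)$.
   Context: A manifold is a non-empty, connected, Hausdorff space each point of which has a neighbourhood homeomorphic to $\mathbb R^n$ for some natural number $n$. An open cover of a space $X$ is a set of open subsets of $X$ whose union is $X$; covers are not assumed to be countable. For a space $X$: - $\mathcal O$ is the family of all open covers of $X$. - $\Lambda$ is the family of large covers of $X$: open covers $\mathcal U$ such that $X\notin\mathcal U$ and every point of $X$ is contained in infinitely many members of $\mathcal U$. - $\Omega$ is the family of $\omega$-covers of $X$: open covers $\mathcal U$ such that $X\notin\mathcal U$ and every finite subset of $X$ is contained in some member of $\mathcal U$. - $\mathcal K$ is the family of $k$-covers of $X$: open covers $\mathcal U$ such that $X\notin\mathcal U$ and every compact subset of $X$ is contained in some member of $\mathcal U$. A space $X$ satisfies $\mathsf S_{fin}(\mathcal A,\mathcal B)$ if for each sequence $\langle A_n\rangle_{n\in\omega}$ of members of $\mathcal A$ there is a sequence $\langle B_n\rangle_{n\in\omega}$ of finite sets such that $B_n\subset A_n$ for each $n$ and $\bigcup_{n\in\omega}B_n\in\mathcal B$. *)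

theory Defs
  imports "HOL-Analysis.Analysis"
begin

(* The neighbourhood N need not be open, and its dimension n may depend on the point. *)
definition manifold :: "'a topology \<Rightarrow> bool" where
  "manifold X \<longleftrightarrow>
     topspace X \<noteq> {} \<and> connected_space X \<and> Hausdorff_space X \<and>
     (\<forall>x \<in> topspace X. \<exists>n N.
        N \<subseteq> topspace X \<and> x \<in> X interior_of N \<and>
        subtopology X N homeomorphic_space Euclidean_space n)"

definition open_covers :: "'a topology \<Rightarrow> 'a set set set" where
  "open_covers X = {\<U>. (\<forall>U \<in> \<U>. openin X U) \<and> \<Union>\<U> = topspace X}"

definition large_covers :: "'a topology \<Rightarrow> 'a set set set" where
  "large_covers X = {\<U> \<in> open_covers X.
     topspace X \<notin> \<U> \<and> (\<forall>x \<in> topspace X. infinite {U \<in> \<U>. x \<in> U})}"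

definition omega_covers :: "'a topology \<Rightarrow> 'a set set set" where
  "omega_covers X = {\<U> \<in> open_covers X.
     topspace X \<notin> \<U> \<and> (\<forall>F. finite F \<and> F \<subseteq> topspace X \<longrightarrow> (\<exists>U \<in> \<U>. F \<subseteq> U))}"

definition k_covers :: "'a topology \<Rightarrow> 'a set set set" where
  "k_covers X = {\<U> \<in> open_covers X.
     topspace X \<notin> \<U> \<and> (\<forall>C. compactin X C \<longrightarrow> (\<exists>U \<in> \<U>. C \<subseteq> U))}"

definition S_fin :: "'b set set \<Rightarrow> 'b set set \<Rightarrow> bool" where
  "S_fin \<A> \<B> \<longleftrightarrow>
     (\<forall>A :: nat \<Rightarrow> 'b set. (\<forall>n. A n \<in> \<A>) \<longrightarrow>
        (\<exists>B :: nat \<Rightarrow> 'b set. (\<forall>n. finite (B n) \<and> B n \<subseteq> A n) \<and> (\<Union>n. B n) \<in> \<B>))"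

end

theory Submission
  imports Defs
begin

text \<open>Every \<open>k\<close>-cover is an \<open>\<omega>\<close>-cover, every \<open>\<omega>\<close>-cover is large, and large covers are open covers,
  so each of the ten principles implies the one for \<open>k\<close>-covers and open covers, and each follows
  from one of the four diagonal ones. If the manifold is not second countable, its second countable
  open subsets form a \<open>k\<close>-cover, and a countable subcover would contradict this; second countability
  gives metrisability by Urysohn's theorem. Conversely, a connected locally compact metrizable space
  has an exhaustion by compact sets that absorbs every compact set, and from the \<open>n\<close>-th cover one
  selects finitely many members that deal with the \<open>n\<close>-th compact set.\<close>

section \<open>Urysohn's metrization theorem\<close>

text \<open>Urysohn functions attached to countably many pairs of basic open sets embed
  \<open>X\<close> into a countable power of the real line, which is metrizable.\<close>

lemma regular_second_countable_imp_metrizable_space: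
  assumes reg: "regular_space X" and haus: "Hausdorff_space X" and sc: "second_countable X"
  shows "metrizable_space X"
proof -
  have norm: "normal_space X"
    by (rule hereditarily_inc[OF regular_second_countable_imp_hereditarily_normal_space])
      (use reg sc in simp)
  obtain \<B> where \<B>: "countable \<B>" "\<And>V. V \<in> \<B> \<Longrightarrow> openin X V"
    and base: "\<And>U x. openin X U \<Longrightarrow> x \<in> U \<Longrightarrow> \<exists>V\<in>\<B>. x \<in> V \<and> V \<subseteq> U"
    using sc unfolding second_countable_def by metis
  \<comment> \<open>Only pairs of members of the countable base are used, so that \<open>I\<close>
    is countable. By regularity, each open neighbourhood of a point still contains such a pair
    around that point (\<open>sep\<close>).\<close>
  define I where "I = {(U, V). U \<in> \<B> \<and> V \<in> \<B> \<and> X closure_of U \<subseteq> V}"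
  have "countable I"
    by (rule countable_subset[of _ "\<B> \<times> \<B>"]) (use \<B>(1) in \<open>auto simp: I_def\<close>)
  have sep: "\<exists>p\<in>I. x \<in> fst p \<and> snd p \<subseteq> W" if W: "openin X W" "x \<in> W" for W x
  proof -
    obtain V where V: "V \<in> \<B>" "x \<in> V" "V \<subseteq> W"
      using base[OF W] by blast
    have "neighbourhood_base_of (closedin X) X"
      using reg by (simp add: neighbourhood_base_of_closedin)
    then obtain S T where ST: "openin X S" "closedin X T" "x \<in> S" "S \<subseteq> T" "T \<subseteq> V"
      using \<B>(2)[OF V(1)] V(2) unfolding neighbourhood_base_of by meson
    obtain U where U: "U \<in> \<B>" "x \<in> U" "U \<subseteq> S"
      using base[OF ST(1,3)] by blast
    have "X closure_of U \<subseteq> V"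
      using closure_of_minimal[of U T X] ST U by (meson order_trans)
    then have "(U, V) \<in> I"
      using U V by (simp add: I_def)
    then show ?thesis
      using U(2) V(3) by (intro bexI[of _ "(U, V)"]) simp_all
  qed
  have "\<exists>f. continuous_map X euclideanreal f \<and> f ` (X closure_of fst p) \<subseteq> {0}
            \<and> f ` (topspace X - snd p) \<subseteq> {1}" if "p \<in> I" for p
  proof -
    have "closedin X (topspace X - snd p)" "disjnt (X closure_of fst p) (topspace X - snd p)"
      using that \<B>(2) by (auto simp: I_def disjnt_iff)
    then show ?thesis
      using norm unfolding normal_space_iff_Urysohn_alt by auto
  qed
  then obtain f where cf: "\<And>p. p \<in> I \<Longrightarrow> continuous_map X euclideanreal (f p)"
    and f0: "\<And>p. p \<in> I \<Longrightarrow> f p ` (X closure_of fst p) \<subseteq> {0}"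
    and f1: "\<And>p. p \<in> I \<Longrightarrow> f p ` (topspace X - snd p) \<subseteq> {1::real}"
    by metis
  define Y where "Y = product_topology (\<lambda>_. euclideanreal) I"
  \<comment> \<open>Restricting to \<open>I\<close> makes \<open>e x\<close> extensional, as points
    of the product must be.\<close>
  define e where "e = (\<lambda>x. \<lambda>p\<in>I. f p x)"
  \<comment> \<open>This one fact gives both injectivity and openness of \<open>e\<close>. The
    witness \<open>N\<close> bounds a single coordinate \<open>p\<close> by 1/2: \<open>f p\<close>
    is 0 at \<open>x\<close> and 1 off \<open>W\<close>.\<close>
  have nbhd: "\<exists>N. openin Y N \<and> e x \<in> N \<and> (\<forall>z\<in>topspace X. e z \<in> N \<longrightarrow> z \<in> W)"
    if W: "openin X W" "x \<in> W" for W x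
  proof -
    obtain p where p: "p \<in> I" "x \<in> fst p" "snd p \<subseteq> W"
      using sep[OF W] by blast
    have xX: "x \<in> topspace X"
      using openin_subset[OF W(1)] W(2) by (rule subsetD)
    have fx: "f p x = 0"
      using f0[OF p(1)] p(2) closure_of_subset_Int[of X "fst p"] xX by blast
    define N where "N = {y \<in> topspace Y. y p \<in> {..<1/2}}"
    have "openin Y N"
      unfolding N_def Y_def
      by (rule openin_continuous_map_preimage[OF continuous_map_product_projection[OF p(1)]]) simp
    moreover have "e x \<in> N"
      using fx p(1) by (simp add: N_def Y_def e_def)
    moreover have "z \<in> W" if "z \<in> topspace X" "e z \<in> N" for z
    proof (rule ccontr)
      assume "z \<notin> W"
      then have "f p z = 1"
        using f1[OF p(1)] p(3) that(1) by blast
      then show False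
        using that(2) p(1) by (simp add: N_def e_def)
    qed
    ultimately show ?thesis
      by blast
  qed
  have "homeomorphic_map X (subtopology Y (e ` topspace X)) e"
  proof (rule bijective_open_imp_homeomorphic_map)
    show "continuous_map X (subtopology Y (e ` topspace X)) e"
      using cf by (auto simp: continuous_map_in_subtopology Y_def continuous_map_componentwise e_def)
    have "e ` topspace X \<subseteq> topspace Y"
      by (auto simp: Y_def e_def)
    then show "e ` topspace X = topspace (subtopology Y (e ` topspace X))"
      by auto
    show "inj_on e (topspace X)"
    proof (rule inj_onI, rule ccontr)
      fix x y assume xy: "x \<in> topspace X" "y \<in> topspace X" "e x = e y" "x \<noteq> y"
      then have "openin X (topspace X - {y})"
        using haus by (simp add: closedin_Hausdorff_singleton openin_diff)
      with nbhd[of _ x] xy show False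
        by (metis Diff_iff singletonI singletonD)
    qed
    show "open_map X (subtopology Y (e ` topspace X)) e"
      unfolding open_map_def
    proof (intro allI impI)
      fix W assume W: "openin X W"
      show "openin (subtopology Y (e ` topspace X)) (e ` W)"
      proof (subst openin_subopen, intro ballI)
        fix y assume "y \<in> e ` W"
        then obtain x where x: "x \<in> W" "y = e x" by blast
        obtain N where "openin Y N" "e x \<in> N" "\<forall>z\<in>topspace X. e z \<in> N \<longrightarrow> z \<in> W"
          using nbhd[OF W x(1)] by blast
        then show "\<exists>T. openin (subtopology Y (e ` topspace X)) T \<and> y \<in> T \<and> T \<subseteq> e ` W"
          using x openin_subset[OF W]
          by (intro exI[of _ "N \<inter> e ` topspace X"]) (auto simp: openin_subtopology)
      qed
    qed
  qed
  moreover have "metrizable_space Y"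
    using \<open>countable I\<close>
    by (simp add: Y_def metrizable_space_product_topology metrizable_space_euclidean)
  ultimately show ?thesis
    by (metis homeomorphic_map_imp_homeomorphic_space homeomorphic_metrizable_space
        metrizable_space_subtopology)
qed

section \<open>Compact exhaustions of connected locally compact metrizable spaces\<close>

text \<open>Total boundedness provides a finite net \<open>F n\<close> of mesh
  \<open>1 / (n + 1)\<close> inside \<open>K\<close>; the union of these nets is dense in
  \<open>K\<close>.\<close>

lemma (in Metric_space) compactin_imp_countable_dense_subset:
  assumes "compactin mtopology K"
  obtains D where "countable D" "D \<subseteq> K" "K \<subseteq> mtopology closure_of D"
proof -
  have tb: "mtotally_bounded K"
    by (rule compactin_imp_mtotally_bounded[OF assms])
  then have "\<exists>F. finite F \<and> F \<subseteq> K \<and> K \<subseteq> (\<Union>x\<in>F. mball x (1 / real (Suc n)))" for n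
    unfolding mtotally_bounded_def by (meson divide_pos_pos of_nat_0_less_iff zero_less_Suc zero_less_one)
  then obtain F where F: "\<And>n. finite (F n)" "\<And>n. F n \<subseteq> K"
    "\<And>n. K \<subseteq> (\<Union>x\<in>F n. mball x (1 / real (Suc n)))"
    by metis
  have "K \<subseteq> mtopology closure_of (\<Union>n. F n)"
  proof
    fix y assume y: "y \<in> K"
    then have yM: "y \<in> M"
      using mtotally_bounded_imp_subset[OF tb] by blast
    have "\<exists>x\<in>\<Union>n. F n. x \<in> mball y r" if "r > 0" for r
    proof -
      obtain n where n: "1 / real (Suc n) < r"
        using reals_Archimedean[OF \<open>r > 0\<close>] by (auto simp: inverse_eq_divide)
      obtain x where "x \<in> F n" "y \<in> mball x (1 / real (Suc n))"
        using F(3) y by blast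
      then have "x \<in> mball y r"
        using n by (auto simp: commute)
      with \<open>x \<in> F n\<close> show ?thesis by blast
    qed
    then show "y \<in> mtopology closure_of (\<Union>n. F n)"
      using yM by (auto simp: metric_closure_of)
  qed
  moreover have "countable (\<Union>n. F n)"
    using F(1) by (auto intro: countable_finite)
  ultimately show thesis
    using that F(2) by blast
qed

text \<open>Starting from one point, adjoin countable dense subsets of those balls of radius
  \<open>1 / (k + 1)\<close> around the points found so far that lie in a compact set. The union of these
  balls is open, and it is closed because a limit point lies in such a ball around a nearby point;
  so it is the whole space.\<close>

lemma connected_locally_compact_metrizable_imp_sigma_compact:
  assumes conn: "connected_space X" and lc: "locally_compact_space X" and "metrizable_space X"
  obtains \<W> where "countable \<W>" "\<Union>\<W> = topspace X"
    "\<And>W. W \<in> \<W> \<Longrightarrow> openin X W \<and> (\<exists>K. compactin X K \<and> W \<subseteq> K)"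
proof (cases "topspace X = {}")
  case True
  then show ?thesis
    using that[of "{}"] by simp
next
  case False
  then obtain x0 where x0: "x0 \<in> topspace X" by blast
  obtain M d where "Metric_space M d" and X: "X = Metric_space.mtopology M d"
    using assms(3) unfolding metrizable_space_def by blast
  interpret Metric_space M d by fact
  define B where "B = (\<lambda>x k. mball x (1 / real (Suc k)))"
  define good where "good = (\<lambda>x k. \<exists>K. compactin X K \<and> B x k \<subseteq> K)"
  \<comment> \<open>For a ball that is not good the empty set serves as a default, so that
    \<open>S\<close> is total and always countable.\<close>
  have "\<exists>S. countable S \<and> S \<subseteq> M \<and> (good x k \<longrightarrow> B x k \<subseteq> X closure_of S)" for x k
  proof (cases "good x k")
    case True
    then obtain K where K: "compactin X K" "B x k \<subseteq> K"
      unfolding good_def by blast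
    then obtain D where "countable D" "D \<subseteq> K" "K \<subseteq> X closure_of D"
      unfolding X using compactin_imp_countable_dense_subset by metis
    then show ?thesis
      using K(2) compactin_subset_topspace[OF K(1)] X by (intro exI[of _ D]) auto
  qed (auto intro: exI[of _ "{}"])
  then obtain S where S: "\<And>x k. countable (S x k)" "\<And>x k. S x k \<subseteq> M"
      "\<And>x k. good x k \<Longrightarrow> B x k \<subseteq> X closure_of (S x k)"
    by metis
  \<comment> \<open>\<open>D n\<close> holds the points found in round \<open>n\<close>, starting
    from the single point \<open>x0\<close>.\<close>
  define D where "D = (\<lambda>n. ((\<lambda>E. \<Union>x\<in>E. \<Union>k. S x k) ^^ n) {x0})"
  have D0: "D 0 = {x0}" and DS: "D (Suc n) = (\<Union>x\<in>D n. \<Union>k. S x k)" for n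
    by (auto simp: D_def)
  define E where "E = (\<Union>n. D n)"
  have "countable (D n)" for n
    by (induction n) (auto simp: D0 DS S(1))
  then have cE: "countable E"
    by (auto simp: E_def)
  define \<W> where "\<W> = {B x k |x k. x \<in> E \<and> good x k}"
  have cover: "y \<in> \<Union>\<W>" if y: "y \<in> X closure_of E" for y
  proof -
    have yM: "y \<in> topspace X"
      using y in_closure_of by fast
    then obtain U K where UK: "openin X U" "compactin X K" "y \<in> U" "U \<subseteq> K"
      using lc unfolding locally_compact_space_def by blast
    then obtain r where r: "r > 0" "mball y r \<subseteq> U"
      using X openin_mtopology by auto
    \<comment> \<open>Half of \<open>r\<close> is taken so that a ball of radius
      \<open>1 / (k + 1)\<close> around a point that close to \<open>y\<close> stays inside
      \<open>mball y r\<close>, hence inside the compact set \<open>K\<close>.\<close>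
    obtain k where k: "1 / real (Suc k) < r / 2"
      using reals_Archimedean[of "r/2"] r by (auto simp: inverse_eq_divide)
    have "1 / real (Suc k) > 0" by simp
    then obtain x where x: "x \<in> E" "x \<in> mball y (1 / real (Suc k))"
      using y unfolding X metric_closure_of by blast
    have "B x k \<subseteq> mball y r"
    proof
      fix z assume "z \<in> B x k"
      then show "z \<in> mball y r"
        using x(2) k triangle[of y x z] by (auto simp: B_def)
    qed
    then have "good x k"
      unfolding good_def using r UK by blast
    moreover have "y \<in> B x k"
      using x(2) by (auto simp: B_def commute)
    ultimately show ?thesis
      using x(1) unfolding \<W>_def by blast
  qed
  have WE: "\<Union>\<W> \<subseteq> X closure_of E"
  proof
    fix y assume "y \<in> \<Union>\<W>"
    then obtain x k n where "x \<in> D n" "good x k" "y \<in> B x k"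
      unfolding \<W>_def E_def by blast
    then have "y \<in> X closure_of (S x k)" "S x k \<subseteq> D (Suc n)"
      using S(3) by (auto simp: DS)
    then show "y \<in> X closure_of E"
      using closure_of_mono[of "S x k" E X] unfolding E_def by blast
  qed
  have open_W: "openin X W" if "W \<in> \<W>" for W
    using that X by (auto simp: \<W>_def B_def)
  have "\<Union>\<W> = X closure_of E"
    using cover WE by blast
  then have "closedin X (\<Union>\<W>)"
    by simp
  moreover have "openin X (\<Union>\<W>)"
    using open_W by blast
  moreover have "x0 \<in> \<Union>\<W>"
  proof (rule cover)
    have "x0 \<in> E"
      using D0 unfolding E_def by blast
    then show "x0 \<in> X closure_of E"
      using x0 by (simp add: in_closure_of) blast
  qed
  ultimately have "\<Union>\<W> = topspace X"
    using conn unfolding connected_space_clopen_in by blast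
  moreover have "countable \<W>"
  proof -
    have "\<W> \<subseteq> (\<lambda>(x, k). B x k) ` (E \<times> UNIV)"
      unfolding \<W>_def by auto
    then show ?thesis
      using cE by (meson countable_SIGMA countable_image countable_subset countableI_type)
  qed
  moreover have "\<exists>K. compactin X K \<and> W \<subseteq> K" if "W \<in> \<W>" for W
    using that by (auto simp: \<W>_def good_def)
  ultimately show ?thesis
    using that[of \<W>] open_W by simp
qed

text \<open>This is hemicompactness with an increasing witness. The last clause also makes the sets
  cover the space, since points are compact.\<close>

definition compact_exhaustion :: "'a topology \<Rightarrow> (nat \<Rightarrow> 'a set) \<Rightarrow> bool" where
  "compact_exhaustion X C \<longleftrightarrow> (\<forall>n. compactin X (C n)) \<and> incseq C \<and>
     (\<forall>K. compactin X K \<longrightarrow> (\<exists>n. K \<subseteq> C n))"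

text \<open>Take the union of compact hulls of the first few members of a countable open cover. A
  compact set is covered by finitely many members, so it is absorbed at some stage.\<close>

lemma connected_locally_compact_metrizable_imp_compact_exhaustion:
  assumes "connected_space X" "locally_compact_space X" "metrizable_space X"
  obtains C where "compact_exhaustion X C"
proof -
  obtain \<W> where \<W>: "countable \<W>" "\<Union>\<W> = topspace X"
    "\<And>W. W \<in> \<W> \<Longrightarrow> openin X W \<and> (\<exists>K. compactin X K \<and> W \<subseteq> K)"
    using connected_locally_compact_metrizable_imp_sigma_compact[OF assms] by metis
  then obtain H where H: "\<And>W. W \<in> \<W> \<Longrightarrow> compactin X (H W) \<and> W \<subseteq> H W"
    by metis
  \<comment> \<open>\<open>to_nat_on\<close> is injective on the countable family, finite or not, so
    only finitely many members have an index below \<open>n\<close>.\<close>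
  define C where "C = (\<lambda>n. \<Union>(H ` {W\<in>\<W>. to_nat_on \<W> W < n}))"
  have fin: "finite {W\<in>\<W>. to_nat_on \<W> W < n}" for n
  proof -
    have "inj_on (to_nat_on \<W>) {W\<in>\<W>. to_nat_on \<W> W < n}"
      using inj_on_to_nat_on[OF \<W>(1)] by (rule inj_on_subset) blast
    then show ?thesis
      by (rule inj_on_finite[where B = "{..<n}"]) auto
  qed
  have "compactin X (C n)" for n
    unfolding C_def by (rule compactin_Union) (use fin H in auto)
  moreover have "incseq C"
    by (auto simp: C_def incseq_def)
  moreover have "\<exists>n. K \<subseteq> C n" if K: "compactin X K" for K
  proof -
    obtain \<F> where \<F>: "finite \<F>" "\<F> \<subseteq> \<W>" "K \<subseteq> \<Union>\<F>"
      using compactinD[OF K, of \<W>] \<W> compactin_subset_topspace[OF K] by auto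
    \<comment> \<open>If \<open>\<F>\<close> is empty, this value is unspecified but harmless,
      because then \<open>K\<close> is empty.\<close>
    define n where "n = Suc (Max (to_nat_on \<W> ` \<F>))"
    have "to_nat_on \<W> W < n" if "W \<in> \<F>" for W
      using \<F>(1) that by (simp add: n_def less_Suc_eq_le)
    then have "W \<subseteq> C n" if "W \<in> \<F>" for W
      using that \<F>(2) H[of W] by (auto simp: C_def)
    then have "K \<subseteq> C n"
      using \<F>(3) by blast
    then show ?thesis ..
  qed
  ultimately show thesis
    using that[of C] by (simp add: compact_exhaustion_def)
qed

section \<open>Selection principles\<close>

lemma S_fin_mono:
  assumes "S_fin \<A> \<B>" "\<A>' \<subseteq> \<A>" "\<B> \<subseteq> \<B>'"
  shows "S_fin \<A>' \<B>'"
  unfolding S_fin_def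
proof (intro allI impI)
  fix A :: "nat \<Rightarrow> _" assume "\<forall>n. A n \<in> \<A>'"
  then have "\<forall>n. A n \<in> \<A>"
    using assms(2) by blast
  then obtain B where "\<forall>n. finite (B n) \<and> B n \<subseteq> A n" "(\<Union>n. B n) \<in> \<B>"
    using assms(1)[unfolded S_fin_def, rule_format, of A] by blast
  then show "\<exists>B. (\<forall>n. finite (B n) \<and> B n \<subseteq> A n) \<and> (\<Union>n. B n) \<in> \<B>'"
    using assms(3) by blast
qed

section \<open>Inclusions among the families of covers\<close>

lemma k_covers_subset_omega_covers: "k_covers X \<subseteq> omega_covers X"
  unfolding k_covers_def omega_covers_def using finite_imp_compactin by auto

text \<open>If only finitely many members contained \<open>x\<close>, then \<open>x\<close> together
  with one point missed by each of them would be a finite set inside no member.\<close>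

lemma omega_covers_subset_large_covers: "omega_covers X \<subseteq> large_covers X"
proof
  fix \<U> assume U: "\<U> \<in> omega_covers X"
  have "infinite {U \<in> \<U>. x \<in> U}" if x: "x \<in> topspace X" for x
  proof
    assume fin: "finite {U \<in> \<U>. x \<in> U}"
    have "\<exists>y. y \<in> topspace X \<and> y \<notin> V" if "V \<in> \<U>" for V
    proof -
      have "openin X V" "V \<noteq> topspace X"
        using U that by (auto simp: omega_covers_def open_covers_def)
      then show ?thesis
        using openin_subset by blast
    qed
    then obtain y where y: "\<And>V. V \<in> \<U> \<Longrightarrow> y V \<in> topspace X \<and> y V \<notin> V"
      by metis
    define F where "F = insert x (y ` {U \<in> \<U>. x \<in> U})"
    have "finite F" "F \<subseteq> topspace X"
      using fin x y by (auto simp: F_def)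
    then obtain V where "V \<in> \<U>" "F \<subseteq> V"
      using U unfolding omega_covers_def by blast
    then show False
      using y unfolding F_def by blast
  qed
  then show "\<U> \<in> large_covers X"
    using U by (auto simp: omega_covers_def large_covers_def)
qed

lemma large_covers_subset_open_covers: "large_covers X \<subseteq> open_covers X"
  by (auto simp: large_covers_def)

section \<open>Diagonal selection principles from a compact exhaustion\<close>

text \<open>A singleton is compact, and monotonicity keeps the point in all later sets. Large covers
  need this for a whole tail of indices.\<close>

lemma compact_exhaustion_covers:
  assumes "compact_exhaustion X C" "x \<in> topspace X"
  shows "\<exists>n. \<forall>m\<ge>n. x \<in> C m"
proof -
  obtain n where "{x} \<subseteq> C n"
    using assms unfolding compact_exhaustion_def by (metis compactin_sing)
  moreover have "incseq C"
    using assms(1) by (simp add: compact_exhaustion_def)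
  ultimately show ?thesis
    by (metis incseqD insert_subset subsetD)
qed

lemma compact_exhaustion_Union_covers:
  assumes C: "compact_exhaustion X C" and B: "\<And>n. C n \<subseteq> \<Union>(B n)"
  shows "topspace X \<subseteq> \<Union>(\<Union>n. B n)"
proof
  fix x assume "x \<in> topspace X"
  then obtain n where "x \<in> C n"
    using compact_exhaustion_covers[OF C] by blast
  then obtain U where "U \<in> B n" "x \<in> U"
    using B by blast
  then show "x \<in> \<Union>(\<Union>n. B n)"
    by (intro UnionI[of U]) auto
qed

text \<open>The common last step of the four selection arguments below: only the covering of all
  points remains to be checked.\<close>

lemma open_covers_UN_subset:
  assumes "\<And>n. A n \<in> open_covers X" "\<And>n. B n \<subseteq> A n" "topspace X \<subseteq> \<Union>(\<Union>n. B n)"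
  shows "(\<Union>n. B n) \<in> open_covers X"
proof -
  have "openin X U" if U: "U \<in> (\<Union>n. B n)" for U
  proof -
    obtain n where "U \<in> B n"
      using U by (rule UN_E)
    then have "U \<in> A n"
      using assms(2) by auto
    then show ?thesis
      using assms(1)[of n] by (simp add: open_covers_def)
  qed
  moreover from this have "\<Union>(\<Union>n. B n) \<subseteq> topspace X"
    by (meson Sup_least openin_subset)
  ultimately show ?thesis
    using assms(3) by (simp add: open_covers_def subset_antisym)
qed

text \<open>The classical proof of the Menger property for sigma-compact spaces: \<open>B n\<close>
  is a finite subcover of \<open>C n\<close>.\<close>

lemma compact_exhaustion_imp_S_fin_open:
  assumes C: "compact_exhaustion X C"
  shows "S_fin (open_covers X) (open_covers X)"
  unfolding S_fin_def
proof (intro allI impI)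
  fix A :: "nat \<Rightarrow> _" assume A: "\<forall>n. A n \<in> open_covers X"
  have "\<exists>B. finite B \<and> B \<subseteq> A n \<and> C n \<subseteq> \<Union>B" for n
  proof (rule compactinD)
    show "compactin X (C n)"
      using C by (simp add: compact_exhaustion_def)
    then show "C n \<subseteq> \<Union>(A n)"
      using A compactin_subset_topspace by (fastforce simp: open_covers_def)
  qed (use A in \<open>auto simp: open_covers_def\<close>)
  then obtain B where B: "\<And>n. finite (B n)" "\<And>n. B n \<subseteq> A n" "\<And>n. C n \<subseteq> \<Union>(B n)"
    by metis
  have "topspace X \<subseteq> \<Union>(\<Union>n. B n)"
    by (rule compact_exhaustion_Union_covers[OF C B(3)])
  then have "(\<Union>n. B n) \<in> open_covers X"
    using open_covers_UN_subset[of A X B] A B(2) by blast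
  then show "\<exists>B. (\<forall>n. finite (B n) \<and> B n \<subseteq> A n) \<and> (\<Union>n. B n) \<in> open_covers X"
    using B by (intro exI[of _ B]) simp
qed

text \<open>A single member of each cover suffices: \<open>U n\<close> contains \<open>C n\<close>,
  and every compact set lies in some \<open>C n\<close>.\<close>

lemma compact_exhaustion_imp_S_fin_k:
  assumes C: "compact_exhaustion X C"
  shows "S_fin (k_covers X) (k_covers X)"
  unfolding S_fin_def
proof (intro allI impI)
  fix A :: "nat \<Rightarrow> _" assume A: "\<forall>n. A n \<in> k_covers X"
  have "\<exists>U. U \<in> A n \<and> C n \<subseteq> U" for n
  proof -
    have "compactin X (C n)"
      using C by (simp add: compact_exhaustion_def)
    moreover have "\<forall>K. compactin X K \<longrightarrow> (\<exists>U\<in>A n. K \<subseteq> U)"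
      using A by (simp add: k_covers_def)
    ultimately show ?thesis
      by blast
  qed
  then obtain U where U: "\<And>n. U n \<in> A n" "\<And>n. C n \<subseteq> U n"
    by metis
  have kc: "\<exists>n. K \<subseteq> U n" if K: "compactin X K" for K
  proof -
    obtain n where "K \<subseteq> C n"
      using K C unfolding compact_exhaustion_def by meson
    then show ?thesis
      using U(2)[of n] by (meson order_trans)
  qed
  have "topspace X \<subseteq> \<Union>(\<Union>n. {U n})"
    by (rule compact_exhaustion_Union_covers[OF C]) (use U(2) in simp)
  then have "(\<Union>n. {U n}) \<in> open_covers X"
    using open_covers_UN_subset[of A X "\<lambda>n. {U n}"] A U(1) by (simp add: k_covers_def)
  then have "(\<Union>n. {U n}) \<in> k_covers X"
    using A U(1) kc unfolding k_covers_def by auto metis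
  then show "\<exists>B. (\<forall>n. finite (B n) \<and> B n \<subseteq> A n) \<and> (\<Union>n. B n) \<in> k_covers X"
    using U(1) by (intro exI[of _ "\<lambda>n. {U n}"]) auto
qed

text \<open>Deleting finitely many members from a large cover leaves a family that still covers
  \<open>K\<close>, so a further finite subcover raises the multiplicity at each point of
  \<open>K\<close> by one.\<close>

lemma large_cover_compactin_finite_multiplicity:
  assumes \<U>: "\<U> \<in> large_covers X" and K: "compactin X K"
  shows "\<exists>\<F>. finite \<F> \<and> \<F> \<subseteq> \<U> \<and> (\<forall>x\<in>K. n \<le> card {U \<in> \<F>. x \<in> U})"
proof (induction n)
  case 0
  show ?case by (rule exI[of _ "{}"]) auto
next
  case (Suc n)
  then obtain \<F> where F: "finite \<F>" "\<F> \<subseteq> \<U>" "\<And>x. x \<in> K \<Longrightarrow> n \<le> card {U \<in> \<F>. x \<in> U}"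
    by blast
  have "K \<subseteq> \<Union>(\<U> - \<F>)"
  proof
    fix x assume "x \<in> K"
    then have "infinite {U \<in> \<U>. x \<in> U}"
      using \<U> compactin_subset_topspace[OF K] by (auto simp: large_covers_def)
    then have "\<not> {U \<in> \<U>. x \<in> U} \<subseteq> \<F>"
      using F(1) finite_subset by blast
    then show "x \<in> \<Union>(\<U> - \<F>)" by blast
  qed
  moreover have "openin X U" if "U \<in> \<U> - \<F>" for U
    using that \<U> by (auto simp: large_covers_def open_covers_def)
  ultimately obtain \<G> where G: "finite \<G>" "\<G> \<subseteq> \<U> - \<F>" "K \<subseteq> \<Union>\<G>"
    using compactinD[OF K, of "\<U> - \<F>"] by auto
  have "Suc n \<le> card {U \<in> \<F> \<union> \<G>. x \<in> U}" if x: "x \<in> K" for x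
  proof -
    obtain V where V: "V \<in> \<G>" "x \<in> V" using G x by blast
    then have "V \<notin> {U \<in> \<F>. x \<in> U}" "insert V {U \<in> \<F>. x \<in> U} \<subseteq> {U \<in> \<F> \<union> \<G>. x \<in> U}"
      using G(2) by auto
    then have "card (insert V {U \<in> \<F>. x \<in> U}) \<le> card {U \<in> \<F> \<union> \<G>. x \<in> U}"
      using F(1) G(1) by (intro card_mono) auto
    then show ?thesis
      using F(1) F(3)[OF x] \<open>V \<notin> {U \<in> \<F>. x \<in> U}\<close> by simp
  qed
  then show ?case
    using F G by (intro exI[of _ "\<F> \<union> \<G>"]) auto
qed

text \<open>The selections \<open>B n\<close> may repeat the same sets, so infinite multiplicity
  cannot come from one set per stage. Instead \<open>B n\<close> alone covers each point of
  \<open>C n\<close> more than \<open>n\<close> times.\<close>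

lemma compact_exhaustion_imp_S_fin_large:
  assumes C: "compact_exhaustion X C"
  shows "S_fin (large_covers X) (large_covers X)"
  unfolding S_fin_def
proof (intro allI impI)
  fix A :: "nat \<Rightarrow> _" assume A: "\<forall>n. A n \<in> large_covers X"
  have "\<exists>B. finite B \<and> B \<subseteq> A n \<and> (\<forall>x\<in>C n. Suc n \<le> card {U \<in> B. x \<in> U})" for n
    by (rule large_cover_compactin_finite_multiplicity) (use A C in \<open>auto simp: compact_exhaustion_def\<close>)
  then obtain B where B: "\<And>n. finite (B n)" "\<And>n. B n \<subseteq> A n"
      "\<And>n x. x \<in> C n \<Longrightarrow> Suc n \<le> card {U \<in> B n. x \<in> U}"
    by metis
  have inf: "infinite {U \<in> (\<Union>n. B n). x \<in> U}" if "x \<in> topspace X" for x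
  proof
    assume fin: "finite {U \<in> (\<Union>n. B n). x \<in> U}"
    obtain n where n: "\<And>m. m \<ge> n \<Longrightarrow> x \<in> C m"
      using compact_exhaustion_covers[OF C \<open>x \<in> topspace X\<close>] by blast
    \<comment> \<open>Large enough that \<open>x\<close> lies in \<open>C m\<close> and that
      \<open>Suc m\<close> exceeds the supposed finite total.\<close>
    define m where "m = max n (card {U \<in> (\<Union>n. B n). x \<in> U})"
    have "Suc m \<le> card {U \<in> B m. x \<in> U}"
      using B(3) n by (simp add: m_def)
    also have "\<dots> \<le> card {U \<in> (\<Union>n. B n). x \<in> U}"
      by (rule card_mono[OF fin]) auto
    finally show False
      by (simp add: m_def)
  qed
  have "topspace X \<subseteq> \<Union>(\<Union>n. B n)"
  proof
    fix x assume "x \<in> topspace X"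
    then have "{U \<in> (\<Union>n. B n). x \<in> U} \<noteq> {}"
      using inf by (metis finite.emptyI)
    then obtain U where "U \<in> (\<Union>n. B n)" "x \<in> U"
      by blast
    then show "x \<in> \<Union>(\<Union>n. B n)"
      by (rule UnionI)
  qed
  then have "(\<Union>n. B n) \<in> open_covers X"
    using open_covers_UN_subset[of A X B] A B(2) by (simp add: large_covers_def)
  moreover have "topspace X \<notin> (\<Union>n. B n)"
    using A B(2) by (auto simp: large_covers_def)
  ultimately have "(\<Union>n. B n) \<in> large_covers X"
    using inf by (simp add: large_covers_def)
  then show "\<exists>B. (\<forall>n. finite (B n) \<and> B n \<subseteq> A n) \<and> (\<Union>n. B n) \<in> large_covers X"
    using B by (intro exI[of _ B]) simp
qed

text \<open>The powers of the members of an \<open>\<omega>\<close>-cover cover the compact power of \<open>K\<close>.\<close>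

lemma omega_cover_compactin_finite_tuples:
  assumes \<U>: "\<U> \<in> omega_covers X" and K: "compactin X K"
  shows "\<exists>\<F>. finite \<F> \<and> \<F> \<subseteq> \<U> \<and> (\<forall>f \<in> {..<n::nat} \<rightarrow> K. \<exists>U\<in>\<F>. f ` {..<n} \<subseteq> U)"
proof -
  define P where "P = (\<lambda>U::'a set. PiE {..<n} (\<lambda>_. U))"
  have "compactin (product_topology (\<lambda>_. X) {..<n}) (P K)"
    using K by (simp add: P_def compactin_PiE)
  moreover have "openin (product_topology (\<lambda>_. X) {..<n}) V" if "V \<in> P ` \<U>" for V
    using that \<U> by (auto simp: P_def omega_covers_def open_covers_def openin_PiE)
  moreover have "P K \<subseteq> \<Union>(P ` \<U>)"
  proof
    fix f assume f: "f \<in> P K"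
    then have "f ` {..<n} \<subseteq> topspace X"
      using compactin_subset_topspace[OF K] by (auto simp: P_def)
    then obtain U where "U \<in> \<U>" "f ` {..<n} \<subseteq> U"
      using \<U> unfolding omega_covers_def by blast
    then have "f \<in> P U"
      using f by (auto simp: P_def PiE_iff)
    then show "f \<in> \<Union>(P ` \<U>)"
      using \<open>U \<in> \<U>\<close> by blast
  qed
  ultimately obtain \<G> where G: "finite \<G>" "\<G> \<subseteq> P ` \<U>" "P K \<subseteq> \<Union>\<G>"
    using compactinD[of "product_topology (\<lambda>_. X) {..<n}" "P K" "P ` \<U>"] by auto
  then obtain \<F> where F: "finite \<F>" "\<F> \<subseteq> \<U>" "\<G> = P ` \<F>"
    using finite_subset_image[of \<G> P \<U>] by auto
  have "\<exists>U\<in>\<F>. f ` {..<n} \<subseteq> U" if "f \<in> {..<n} \<rightarrow> K" for f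
  proof -
    \<comment> \<open>Elements of \<open>P K\<close> are extensional, whereas \<open>f\<close> is
      arbitrary outside \<open>{..<n}\<close>.\<close>
    have "restrict f {..<n} \<in> P K"
      using that by (auto simp: P_def)
    then obtain U where "U \<in> \<F>" "restrict f {..<n} \<in> P U"
      using G F by blast
    then show ?thesis
      by (intro bexI[of _ U]) (auto simp: P_def PiE_iff)
  qed
  then show ?thesis
    using F by blast
qed

text \<open>The index \<open>n\<close> bounds both the length of the tuples and the compact set they
  come from. Each finite set is, for a large index, the range of such a tuple with
  repetitions.\<close>

lemma compact_exhaustion_imp_S_fin_omega:
  assumes C: "compact_exhaustion X C"
  shows "S_fin (omega_covers X) (omega_covers X)"
  unfolding S_fin_def
proof (intro allI impI)
  fix A :: "nat \<Rightarrow> _" assume A: "\<forall>n. A n \<in> omega_covers X"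
  have "\<exists>B. finite B \<and> B \<subseteq> A n \<and> (\<forall>f \<in> {..<n} \<rightarrow> C n. \<exists>U\<in>B. f ` {..<n} \<subseteq> U)" for n
    by (rule omega_cover_compactin_finite_tuples) (use A C in \<open>auto simp: compact_exhaustion_def\<close>)
  then obtain B where B: "\<And>n. finite (B n)" "\<And>n. B n \<subseteq> A n"
      "\<And>n f. f \<in> {..<n} \<rightarrow> C n \<Longrightarrow> \<exists>U\<in>B n. f ` {..<n} \<subseteq> U"
    by metis
  have om: "\<exists>U\<in>(\<Union>n. B n). F \<subseteq> U" if F: "finite F" "F \<subseteq> topspace X" for F
  proof (cases "F = {}")
    case True
    then show ?thesis
      \<comment> \<open>Every function is a tuple of length 0, so this instance just says that
        \<open>B 0\<close> has a member.\<close>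
      using B(3)[of undefined 0] by auto
  next
    case False
    then obtain a where a: "a \<in> F" by blast
    obtain h where h: "bij_betw h {0..<card F} F"
      using ex_bij_betw_nat_finite[OF F(1)] by blast
    obtain n where n: "F \<subseteq> C n"
      using C finite_imp_compactin[OF F(2,1)] unfolding compact_exhaustion_def by blast
    define m where "m = max n (card F)"
    have Fm: "F \<subseteq> C m"
      using C n unfolding compact_exhaustion_def incseq_def m_def by (meson max.cobounded1 order_trans)
    \<comment> \<open>The enumeration \<open>h\<close> of \<open>F\<close> is padded to length
      \<open>m\<close> by repeating \<open>a\<close>.\<close>
    define f where "f = (\<lambda>i. if i < card F then h i else a)"
    have hF: "h ` {0..<card F} = F"
      using h by (simp add: bij_betw_def)
    then have "f \<in> {..<m} \<rightarrow> C m"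
      using Fm a by (fastforce simp: f_def)
    then obtain U where U: "U \<in> B m" "f ` {..<m} \<subseteq> U"
      using B(3) by blast
    have "F \<subseteq> f ` {..<m}"
    proof
      fix x assume "x \<in> F"
      then obtain i where "i < card F" "x = h i"
        using hF by force
      then show "x \<in> f ` {..<m}"
        by (intro image_eqI[of _ _ i]) (auto simp: f_def m_def)
    qed
    then show ?thesis
      using U by blast
  qed
  have "topspace X \<subseteq> \<Union>(\<Union>n. B n)"
  proof
    fix x assume "x \<in> topspace X"
    then show "x \<in> \<Union>(\<Union>n. B n)"
      using om[of "{x}"] by auto
  qed
  then have "(\<Union>n. B n) \<in> open_covers X"
    using open_covers_UN_subset[of A X B] A B(2) by (simp add: omega_covers_def)
  moreover have "topspace X \<notin> (\<Union>n. B n)"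
    using A B(2) unfolding omega_covers_def by blast
  ultimately have "(\<Union>n. B n) \<in> omega_covers X"
    using om by (simp add: omega_covers_def)
  then show "\<exists>B. (\<forall>n. finite (B n) \<and> B n \<subseteq> A n) \<and> (\<Union>n. B n) \<in> omega_covers X"
    using B by (intro exI[of _ B]) simp
qed

section \<open>Manifolds\<close>

text \<open>The bases of the pieces together form a base of the union: because the pieces are open,
  their relatively open sets are open in \<open>X\<close>.\<close>

lemma second_countable_Union_open:
  assumes "countable \<U>" "\<And>U. U \<in> \<U> \<Longrightarrow> openin X U \<and> second_countable (subtopology X U)"
  shows "second_countable (subtopology X (\<Union>\<U>))"
proof -
  have "\<exists>\<B>. countable \<B> \<and> (\<forall>V\<in>\<B>. openin X V \<and> V \<subseteq> U) \<and>
     (\<forall>W x. openin X W \<and> x \<in> W \<and> x \<in> U \<longrightarrow> (\<exists>V\<in>\<B>. x \<in> V \<and> V \<subseteq> W))" if "U \<in> \<U>" for U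
  proof -
    obtain \<B> where \<B>: "countable \<B>" "\<forall>V\<in>\<B>. openin (subtopology X U) V"
      "\<forall>W x. openin (subtopology X U) W \<and> x \<in> W \<longrightarrow> (\<exists>V\<in>\<B>. x \<in> V \<and> V \<subseteq> W)"
      using assms(2) \<open>U \<in> \<U>\<close> unfolding second_countable_def by meson
    have "\<exists>V\<in>\<B>. x \<in> V \<and> V \<subseteq> W" if "openin X W" "x \<in> W" "x \<in> U" for W x
      using \<B>(3)[rule_format, of "W \<inter> U" x] that by (auto simp: openin_subtopology_Int)
    moreover have "openin X V \<and> V \<subseteq> U" if "V \<in> \<B>" for V
      using \<B>(2) that assms(2) \<open>U \<in> \<U>\<close> by (auto simp: openin_open_subtopology)
    ultimately show ?thesis
      using \<B>(1) by (intro exI[of _ \<B>]) simp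
  qed
  then obtain \<B> where \<B>: "\<And>U. U \<in> \<U> \<Longrightarrow> countable (\<B> U)"
      "\<And>U V. U \<in> \<U> \<Longrightarrow> V \<in> \<B> U \<Longrightarrow> openin X V \<and> V \<subseteq> U"
      "\<And>U W x. \<lbrakk>U \<in> \<U>; openin X W; x \<in> W; x \<in> U\<rbrakk> \<Longrightarrow> \<exists>V\<in>\<B> U. x \<in> V \<and> V \<subseteq> W"
    by metis
  have op: "openin X (\<Union>\<U>)"
    using assms(2) by blast
  show ?thesis
    unfolding second_countable_def
  proof (intro exI conjI strip)
    show "countable (\<Union>U\<in>\<U>. \<B> U)"
      using assms(1) \<B>(1) by blast
    show "openin (subtopology X (\<Union>\<U>)) V" if V: "V \<in> (\<Union>U\<in>\<U>. \<B> U)" for V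
    proof -
      obtain U where "U \<in> \<U>" "V \<in> \<B> U"
        using V by (rule UN_E)
      then show ?thesis
        using \<B>(2)[of U V] by (auto simp: openin_open_subtopology[OF op])
    qed
    show "\<exists>V\<in>(\<Union>U\<in>\<U>. \<B> U). x \<in> V \<and> V \<subseteq> W"
      if "openin (subtopology X (\<Union>\<U>)) W \<and> x \<in> W" for W x
    proof -
      have W: "openin X W" "x \<in> W" "x \<in> \<Union>\<U>"
        using that by (auto simp: openin_open_subtopology[OF op])
      obtain U where "U \<in> \<U>" "x \<in> U"
        using W(3) by (rule UnionE)
      then obtain V where "V \<in> \<B> U" "x \<in> V" "V \<subseteq> W"
        using \<B>(3)[OF _ W(1,2)] by metis
      then show ?thesis
        using \<open>U \<in> \<U>\<close> by (intro bexI[of _ V]) auto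
    qed
  qed
qed

text \<open>\<open>Euclidean_space n\<close> is a subspace of the countable power of the real line,
  which has a countable base.\<close>

lemma second_countable_Euclidean_space: "second_countable (Euclidean_space n)"
proof -
  obtain \<B> :: "(nat \<Rightarrow> real) set set" where "countable \<B>" "topological_basis \<B>"
    using ex_countable_basis by blast
  then have "second_countable (euclidean :: (nat \<Rightarrow> real) topology)"
    unfolding second_countable_def
    by (metis topological_basisE topological_basis_open open_openin)
  then show ?thesis
    unfolding Euclidean_space_def euclidean_product_topology by (rule second_countable_subtopology)
qed

lemma manifold_imp_locally_compact_space:
  assumes "manifold M"
  shows "locally_compact_space M"
  unfolding locally_compact_space_def
proof
  fix x assume "x \<in> topspace M"
  then obtain n N where N: "N \<subseteq> topspace M" "x \<in> M interior_of N"
      "subtopology M N homeomorphic_space Euclidean_space n"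
    using assms unfolding manifold_def by blast
  have xN: "x \<in> N"
    using N(2) interior_of_subset by fast
  have "locally_compact_space (subtopology M N)"
    using N(3) locally_compact_Euclidean_space homeomorphic_locally_compact_space by blast
  then obtain U K where UK: "openin (subtopology M N) U" "compactin (subtopology M N) K" "x \<in> U" "U \<subseteq> K"
    unfolding locally_compact_space_def using N(1) xN by (metis topspace_subtopology_subset)
  obtain V where V: "openin M V" "U = V \<inter> N"
    using UK(1) by (auto simp: openin_subtopology)
  \<comment> \<open>As \<open>N\<close> need not be open in \<open>M\<close>, the relatively open
    \<open>U\<close> is cut down to the interior of \<open>N\<close>.\<close>
  have "openin M (V \<inter> M interior_of N)" "x \<in> V \<inter> M interior_of N" "V \<inter> M interior_of N \<subseteq> K"
    using V UK N(2) interior_of_subset[of M N] by auto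
  moreover have "compactin M K"
    using UK(2) by (simp add: compactin_subtopology)
  ultimately show "\<exists>U K. openin M U \<and> compactin M K \<and> x \<in> U \<and> U \<subseteq> K"
    by blast
qed

lemma manifold_second_countable_neighbourhood:
  assumes "manifold M" "x \<in> topspace M"
  shows "\<exists>U. openin M U \<and> x \<in> U \<and> second_countable (subtopology M U)"
proof -
  obtain n N where N: "x \<in> M interior_of N" "subtopology M N homeomorphic_space Euclidean_space n"
    using assms unfolding manifold_def by blast
  have "second_countable (subtopology M N)"
    using N(2) second_countable_Euclidean_space homeomorphic_space_second_countability by blast
  then have "second_countable (subtopology (subtopology M N) (M interior_of N))"
    by (rule second_countable_subtopology)
  then have "second_countable (subtopology M (M interior_of N))"
    by (simp add: subtopology_subtopology Int_absorb1 interior_of_subset)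
  then show ?thesis
    using N(1) openin_interior_of by blast
qed

text \<open>The open second countable subsets are closed under countable unions, so unless the whole
  space is one of them they form a \<open>k\<close>-cover.\<close>

lemma S_fin_k_open_imp_second_countable:
  assumes nbhd: "\<And>x. x \<in> topspace X \<Longrightarrow> \<exists>U. openin X U \<and> x \<in> U \<and> second_countable (subtopology X U)"
    and S: "S_fin (k_covers X) (open_covers X)"
  shows "second_countable X"
proof (rule ccontr)
  assume nsc: "\<not> second_countable X"
  define \<U> where "\<U> = {U. openin X U \<and> second_countable (subtopology X U)}"
  have Un: "\<Union>\<V> \<in> \<U>" if "countable \<V>" "\<V> \<subseteq> \<U>" for \<V>
    using that second_countable_Union_open[of \<V> X] by (auto simp: \<U>_def)
  have X: "topspace X \<notin> \<U>"
    using nsc by (simp add: \<U>_def)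
  have cover: "\<Union>\<U> = topspace X"
    using nbhd openin_subset unfolding \<U>_def by blast
  have "\<exists>U\<in>\<U>. K \<subseteq> U" if K: "compactin X K" for K
  proof -
    obtain \<F> where "finite \<F>" "\<F> \<subseteq> \<U>" "K \<subseteq> \<Union>\<F>"
      using compactinD[OF K, of \<U>] cover compactin_subset_topspace[OF K] by (auto simp: \<U>_def)
    then show ?thesis
      using Un[of \<F>] countable_finite[of \<F>] by (intro bexI[of _ "\<Union>\<F>"]) simp_all
  qed
  then have "\<U> \<in> k_covers X"
    using X cover by (auto simp: k_covers_def open_covers_def \<U>_def)
  \<comment> \<open>The principle is applied to the constant sequence \<open>\<U>\<close>. The
    finite selections then form a countable cover of \<open>X\<close>, whose union would have to lie
    in \<open>\<U>\<close>.\<close>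
  then obtain B where B: "\<And>n. finite (B n)" "\<And>n. B n \<subseteq> \<U>" "(\<Union>n::nat. B n) \<in> open_covers X"
    using S[unfolded S_fin_def, rule_format, of "\<lambda>_. \<U>"] by metis
  have "countable (\<Union>n. B n)"
    using B(1) by (auto intro: countable_finite)
  then have "\<Union>(\<Union>n. B n) \<in> \<U>"
    using B(2) by (intro Un) auto
  then show False
    using X B(3) by (simp add: open_covers_def)
qed

theorem theorem1p4:
  fixes M :: "'a topology"
  assumes "manifold M"
    and "(\<A>, \<B>) \<in>
      {(k_covers M, open_covers M), (k_covers M, large_covers M),
       (k_covers M, omega_covers M), (k_covers M, k_covers M),
       (omega_covers M, open_covers M), (omega_covers M, large_covers M),
       (omega_covers M, omega_covers M),
       (large_covers M, open_covers M), (large_covers M, large_covers M),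
       (open_covers M, open_covers M)}"
  shows "metrizable_space M \<longleftrightarrow> S_fin \<A> \<B>"
proof -
  note inclusions = k_covers_subset_omega_covers[of M] omega_covers_subset_large_covers[of M]
    large_covers_subset_open_covers[of M]
  have lc: "locally_compact_space M"
    using assms(1) by (rule manifold_imp_locally_compact_space)
  show ?thesis
  proof
    assume "metrizable_space M"
    then obtain C where C: "compact_exhaustion M C"
      using assms(1) lc connected_locally_compact_metrizable_imp_compact_exhaustion
      unfolding manifold_def by metis
    consider "\<A> = k_covers M" "k_covers M \<subseteq> \<B>"
      | "\<A> = omega_covers M" "omega_covers M \<subseteq> \<B>"
      | "\<A> = large_covers M" "large_covers M \<subseteq> \<B>"
      | "\<A> = open_covers M" "open_covers M \<subseteq> \<B>"
      using assms(2) inclusions by auto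
    then show "S_fin \<A> \<B>"
      using S_fin_mono[OF compact_exhaustion_imp_S_fin_k[OF C]]
        S_fin_mono[OF compact_exhaustion_imp_S_fin_omega[OF C]]
        S_fin_mono[OF compact_exhaustion_imp_S_fin_large[OF C]]
        S_fin_mono[OF compact_exhaustion_imp_S_fin_open[OF C]]
      by cases simp_all
  next
    assume "S_fin \<A> \<B>"
    moreover have "k_covers M \<subseteq> \<A>" "\<B> \<subseteq> open_covers M"
      using assms(2) inclusions by auto
    ultimately have "S_fin (k_covers M) (open_covers M)"
      by (rule S_fin_mono)
    then have "second_countable M"
      using S_fin_k_open_imp_second_countable manifold_second_countable_neighbourhood[OF assms(1)]
      by blast
    moreover have "Hausdorff_space M"
      using assms(1) by (simp add: manifold_def)
    \<comment> \<open>The regularity required for metrization comes from local compactness and the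
      Hausdorff property.\<close>
    ultimately show "metrizable_space M"
      using lc locally_compact_Hausdorff_imp_regular_space
        regular_second_countable_imp_metrizable_space by blast
  qed
qed

end
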